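(* Let $N\ge1$ and consider the weighted spider network $G$ with $N$ legs and parameters $\gamma=(\gamma_1,\gamma_2^{(1)},\dots,\gamma_2^{(N)},\gamma_3)\in\mathbb R_+\times(\mathbb R_+^* )^{N+1}$. Put $\mathcal S_2=\gamma_2^{(1)}+\cdots+\gamma_2^{(N)}$ and $\Lambda=2\gamma_3-\gamma_1-\mathcal S_2$. Then the combinatorial spectral radius of $G$ is $$\rho=\begin{cases}2\gamma_3, & \text{if }\Lambda\ge 0,\\[4pt] \dfrac{2\gamma_3(\gamma_1^2+\mathcal S_2^2)}{\gamma_1(2\gamma_3-\mathcal S_2)+\mathcal S_2\sqrt{\gamma_1^2+4\gamma_3(\mathcal S_2-\gamma_3)}}, & \text{if }\Lambda<0.\end{cases}$$
   Context: The weighted spider network has vertex set $G=\{(n,k):n\in\mathbb N_0,\ 1\le k\le N\}$ with the identification $\mathbf 0=(0,1)=\cdots=(0,N)$. Its weighted adjacency matrix $A$ is given, for $n\ge1$ and $1\le k\le N$, by $A(\mathbf 0,\mathbf 0)=\gamma_1$, $A(\mathbf 0,(1,k))=\gamma_2^{(k)}$, $A((n,k),(n\pm1,k))=\gamma_3$, and $A=0$ otherwise. Here $\mathbb R_+=[0,\infty)$ and $\mathbb R_+^*=(0,\infty)$. The combinatorial spectral radius is the inverse of the radius of convergence of $\sum_{n\ge0}A^n(x,y)z^n$, which does not depend on $x,y\in G$. *)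

theory Defs
  imports "HOL-Analysis.Analysis"
begin

(* The vertices (0,1), ..., (0,N) of the legs are identified: every (0,k) is represented by (0,1). *)

definition spider_vertex :: "nat \<Rightarrow> nat \<Rightarrow> nat \<times> nat" where
  "spider_vertex n k = (if n = 0 then (0, 1) else (n, k))"

abbreviation spider_origin :: "nat \<times> nat" where
  "spider_origin \<equiv> (0, 1)"

definition spider_vertices :: "nat \<Rightarrow> (nat \<times> nat) set" where
  "spider_vertices N = {spider_vertex n k |n k. 1 \<le> k \<and> k \<le> N}"

(* The matrix is not symmetric in general: the entry from the origin to (1,k) is \<gamma>2 k,
   whereas the entry from (1,k) back to the origin is \<gamma>3. *)

definition spider_adj ::
  "nat \<Rightarrow> real \<Rightarrow> (nat \<Rightarrow> real) \<Rightarrow> real \<Rightarrow> nat \<times> nat \<Rightarrow> nat \<times> nat \<Rightarrow> real" where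
  "spider_adj N \<gamma>1 \<gamma>2 \<gamma>3 x y =
     (if x = spider_origin \<and> y = spider_origin then \<gamma>1
      else if x = spider_origin \<and> (\<exists>k. 1 \<le> k \<and> k \<le> N \<and> y = spider_vertex 1 k) then \<gamma>2 (snd y)
      else if \<exists>n k. 1 \<le> n \<and> 1 \<le> k \<and> k \<le> N \<and> x = spider_vertex n k \<and>
                (y = spider_vertex (n + 1) k \<or> y = spider_vertex (n - 1) k) then \<gamma>3
      else 0)"

(* Powers of a matrix indexed by a possibly infinite set V.  For a matrix whose rows have finite
   support, such as spider_adj, the infinite sum is a finite one. *)

primrec mat_power :: "'v set \<Rightarrow> ('v \<Rightarrow> 'v \<Rightarrow> real) \<Rightarrow> nat \<Rightarrow> 'v \<Rightarrow> 'v \<Rightarrow> real" where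
  "mat_power V A 0 x y = (if x = y then 1 else 0)"
| "mat_power V A (Suc n) x y = (\<Sum>\<^sub>\<infinity>z\<in>V. A x z * mat_power V A n z y)"

definition comb_spectral_radius ::
  "'v set \<Rightarrow> ('v \<Rightarrow> 'v \<Rightarrow> real) \<Rightarrow> 'v \<Rightarrow> 'v \<Rightarrow> ereal" where
  "comb_spectral_radius V A x y = inverse (conv_radius (\<lambda>n. mat_power V A n x y))"

end

theory Submission imports Defs begin

text \<open>
  For a nonnegative irreducible matrix with finite rows, a positive vector \<open>f\<close> with
  \<open>A f \<le> \<rho> f\<close> bounds the entries of the powers by a multiple of \<open>\<rho> ^ n\<close>, and a nonzero
  nonnegative vector \<open>v\<close> of finite support with \<open>A v \<ge> \<lambda> v\<close> forces growth at rate at least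
  \<open>\<lambda>\<close>. On the spider both kinds of vectors can be chosen to depend only on the distance
  \<open>n\<close> to the origin. If \<open>\<Lambda> \<ge> 0\<close>, take \<open>f = 1\<close> and the bumps \<open>v n = max 0 (n * (M - n))\<close>.
  If \<open>\<Lambda> < 0\<close>, the equation \<open>\<gamma>3 * (t + 1 / t) = \<gamma>1 + S2 * t\<close> has a root \<open>t\<close> in the open unit
  interval, \<open>f n = t ^ n\<close> is an eigenvector, and its truncations
  \<open>v n = max 0 (t ^ n - \<epsilon>)\<close> are almost eigenvectors.
\<close>

section \<open>Nonnegative matrices with finite rows\<close>

locale row_finite_matrix =
  fixes V :: "'v set" and A :: "'v \<Rightarrow> 'v \<Rightarrow> real"
  assumes entry_nonneg: "x \<in> V \<Longrightarrow> y \<in> V \<Longrightarrow> A x y \<ge> 0"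
    and finite_row: "x \<in> V \<Longrightarrow> finite {z \<in> V. A x z \<noteq> 0}"
begin

text \<open>The summand vanishes off the finite support of the row whatever \<open>u\<close> is, so
  the infinite sums become finite ones and no summability condition on \<open>u\<close>
  arises.\<close>

lemma row_infsum:
  assumes "x \<in> V"
  shows "(\<Sum>\<^sub>\<infinity>z\<in>V. A x z * u z) = (\<Sum>z | z \<in> V \<and> A x z \<noteq> 0. A x z * u z)"
proof -
  have "(\<Sum>\<^sub>\<infinity>z\<in>V. A x z * u z) = (\<Sum>\<^sub>\<infinity>z\<in>{z \<in> V. A x z \<noteq> 0}. A x z * u z)"
    by (rule infsum_cong_neutral) auto
  then show ?thesis
    using finite_row[OF assms] by simp
qed

lemma row_infsum_superset:
  assumes "x \<in> V" "finite R" "R \<subseteq> V" "\<And>z. z \<in> V - R \<Longrightarrow> A x z = 0"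
  shows "(\<Sum>\<^sub>\<infinity>z\<in>V. A x z * u z) = (\<Sum>z\<in>R. A x z * u z)"
proof -
  have "(\<Sum>\<^sub>\<infinity>z\<in>V. A x z * u z) = (\<Sum>\<^sub>\<infinity>z\<in>R. A x z * u z)"
    using assms by (intro infsum_cong_neutral) auto
  then show ?thesis
    using assms(2) by simp
qed

lemma row_infsum_mono:
  assumes "x \<in> V" "\<And>z. z \<in> V \<Longrightarrow> u z \<le> w z"
  shows "(\<Sum>\<^sub>\<infinity>z\<in>V. A x z * u z) \<le> (\<Sum>\<^sub>\<infinity>z\<in>V. A x z * w z)"
  unfolding row_infsum[OF assms(1)]
  using assms entry_nonneg by (intro sum_mono mult_left_mono) auto

lemma row_infsum_scale:
  assumes "x \<in> V"
  shows "(\<Sum>\<^sub>\<infinity>z\<in>V. A x z * (c * u z)) = c * (\<Sum>\<^sub>\<infinity>z\<in>V. A x z * u z)"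
  unfolding row_infsum[OF assms] sum_distrib_left by (simp add: mult_ac)

lemma entry_le_row_infsum:
  assumes "x \<in> V" "y \<in> V" "\<And>z. z \<in> V \<Longrightarrow> u z \<ge> 0"
  shows "A x y * u y \<le> (\<Sum>\<^sub>\<infinity>z\<in>V. A x z * u z)"
proof (cases "A x y = 0")
  case True
  then show ?thesis
    unfolding row_infsum[OF assms(1)] using assms entry_nonneg by (auto intro!: sum_nonneg)
next
  case False
  then show ?thesis
    unfolding row_infsum[OF assms(1)]
    using assms entry_nonneg finite_row[OF assms(1)]
    by (intro member_le_sum[where f = "\<lambda>z. A x z * u z"]) auto
qed

section \<open>Entrywise bounds for matrix powers\<close>

lemma mat_power_nonneg:
  assumes "x \<in> V" "y \<in> V"
  shows "mat_power V A n x y \<ge> 0"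
  using assms
proof (induction n arbitrary: x)
  case (Suc n)
  then show ?case
    by (auto intro!: infsum_nonneg mult_nonneg_nonneg entry_nonneg)
qed simp

text \<open>Walks of length \<open>m + n\<close> that are at \<open>w\<close> after \<open>m\<close>
  steps are only some of all walks from \<open>x\<close> to \<open>y\<close>, and every walk has
  nonnegative weight. The induction peels off the first step.\<close>

lemma mat_power_add_ge:
  assumes "x \<in> V" "y \<in> V" "w \<in> V"
  shows "mat_power V A m x w * mat_power V A n w y \<le> mat_power V A (m + n) x y"
  using assms(1)
proof (induction m arbitrary: x)
  case 0
  then show ?case
    using mat_power_nonneg assms by simp
next
  case (Suc m)
  have "mat_power V A (Suc m) x w * mat_power V A n w y =
      (\<Sum>\<^sub>\<infinity>z\<in>V. A x z * (mat_power V A n w y * mat_power V A m z w))"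
    unfolding row_infsum_scale[OF Suc.prems] by simp
  also have "\<dots> \<le> (\<Sum>\<^sub>\<infinity>z\<in>V. A x z * mat_power V A (m + n) z y)"
    using Suc by (intro row_infsum_mono) (auto simp: mult.commute)
  finally show ?case
    by simp
qed

text \<open>Iterating \<open>A f \<le> c f\<close> bounds \<open>A ^ n f\<close> at \<open>x\<close>
  by \<open>c ^ n * f x\<close>, and the left side is one nonnegative term of that row sum. The
  induction treats this single term, so full row sums of \<open>A ^ n\<close> are never
  formed.\<close>

lemma mat_power_le:
  assumes "x \<in> V" "y \<in> V" "c \<ge> 0"
    and super: "\<And>z. z \<in> V \<Longrightarrow> (\<Sum>\<^sub>\<infinity>w\<in>V. A z w * f w) \<le> c * f z"
    and nonneg: "\<And>z. z \<in> V \<Longrightarrow> f z \<ge> 0"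
  shows "mat_power V A n x y * f y \<le> c ^ n * f x"
  using assms(1)
proof (induction n arbitrary: x)
  case 0
  then show ?case
    using nonneg by simp
next
  case (Suc n)
  have "mat_power V A (Suc n) x y * f y = (\<Sum>\<^sub>\<infinity>z\<in>V. A x z * (f y * mat_power V A n z y))"
    unfolding row_infsum_scale[OF Suc.prems] by simp
  also have "\<dots> \<le> (\<Sum>\<^sub>\<infinity>z\<in>V. A x z * (c ^ n * f z))"
    using Suc by (intro row_infsum_mono) (auto simp: mult.commute)
  also have "\<dots> = c ^ n * (\<Sum>\<^sub>\<infinity>z\<in>V. A x z * f z)"
    by (rule row_infsum_scale[OF Suc.prems])
  also have "\<dots> \<le> c ^ n * (c * f x)"
    using super[OF Suc.prems] assms(3) by (intro mult_left_mono) auto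
  finally show ?case
    by (simp add: mult_ac)
qed

text \<open>Multiplication by a nonnegative matrix is monotone, so \<open>A v \<ge> c v\<close>
  iterates to \<open>A ^ n v \<ge> c ^ n v\<close>. The support of \<open>v\<close> lies in the
  finite set \<open>F\<close>, which makes \<open>A ^ n v\<close> a finite sum.\<close>

lemma mat_power_ge:
  assumes "x \<in> V" "c \<ge> 0" "finite F" "F \<subseteq> V"
    and supp: "\<And>z. z \<in> V - F \<Longrightarrow> v z = 0"
    and sub: "\<And>z. z \<in> V \<Longrightarrow> c * v z \<le> (\<Sum>\<^sub>\<infinity>w\<in>V. A z w * v w)"
  shows "c ^ n * v x \<le> (\<Sum>y\<in>F. mat_power V A n x y * v y)"
  using assms(1)
proof (induction n arbitrary: x)
  case 0
  have "(\<Sum>y\<in>F. mat_power V A 0 x y * v y) = (\<Sum>y\<in>F. if x = y then v y else 0)"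
    by (rule sum.cong) auto
  then show ?case
    using supp[of x] 0 assms(3) by (cases "x \<in> F") simp_all
next
  case (Suc n)
  have "c ^ Suc n * v x = c ^ n * (c * v x)"
    by simp
  also have "\<dots> \<le> c ^ n * (\<Sum>\<^sub>\<infinity>z\<in>V. A x z * v z)"
    using sub[OF Suc.prems] assms(2) by (intro mult_left_mono) auto
  also have "\<dots> = (\<Sum>\<^sub>\<infinity>z\<in>V. A x z * (c ^ n * v z))"
    by (rule row_infsum_scale[OF Suc.prems, symmetric])
  also have "\<dots> \<le> (\<Sum>\<^sub>\<infinity>z\<in>V. A x z * (\<Sum>y\<in>F. mat_power V A n z y * v y))"
    using Suc by (intro row_infsum_mono) auto
  also have "\<dots> = (\<Sum>y\<in>F. mat_power V A (Suc n) x y * v y)"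
    unfolding mat_power.simps row_infsum[OF Suc.prems]
    unfolding sum_distrib_left sum_distrib_right
    by (subst sum.swap) (simp only: mult_ac)
  finally show ?case .
qed

lemma mat_power_reach_trans:
  assumes "x \<in> V" "w \<in> V" "y \<in> V"
    and "mat_power V A m x w > 0" "mat_power V A n w y > 0"
  shows "mat_power V A (m + n) x y > 0"
  using mat_power_add_ge[OF assms(1,3,2), of m n] assms(4,5)
  by (meson less_le_trans mult_pos_pos)

lemma mat_power_1_ge:
  assumes "x \<in> V" "y \<in> V"
  shows "A x y \<le> mat_power V A 1 x y"
  using entry_le_row_infsum[OF assms, of "\<lambda>z. mat_power V A 0 z y"] by simp

end

section \<open>Irreducibility and the radius of convergence\<close>

locale irreducible_matrix = row_finite_matrix +
  assumes irreducible: "x \<in> V \<Longrightarrow> y \<in> V \<Longrightarrow> \<exists>m. mat_power V A m x y > 0"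
begin

text \<open>By \<open>mat_power_le\<close> the entries are at most \<open>f x / f y * c ^ n\<close>,
  so a geometric series of ratio \<open>c * r\<close> dominates the power series at
  \<open>r < 1 / c\<close>.\<close>

lemma conv_radius_ge:
  assumes "x \<in> V" "y \<in> V" "c > 0"
    and "\<And>z. z \<in> V \<Longrightarrow> (\<Sum>\<^sub>\<infinity>w\<in>V. A z w * f w) \<le> c * f z"
    and pos: "\<And>z. z \<in> V \<Longrightarrow> f z > 0"
  shows "conv_radius (\<lambda>n. mat_power V A n x y) \<ge> ereal (1 / c)"
proof (rule conv_radius_geI_ex')
  fix r :: real
  assume r: "0 < r" "ereal r < ereal (1 / c)"
  then have rc: "c * r < 1"
    using assms(3) by (simp add: field_simps)
  have "norm (mat_power V A n x y * of_real r ^ n) \<le> f x / f y * (c * r) ^ n" for n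
  proof -
    have "mat_power V A n x y \<le> f x / f y * c ^ n"
      using mat_power_le[OF assms(1,2), of c f n] assms(3,4) pos[OF assms(2)]
        less_imp_le[OF pos] by (simp add: field_simps)
    then have "mat_power V A n x y * r ^ n \<le> f x / f y * c ^ n * r ^ n"
      using r by (intro mult_right_mono) auto
    then show ?thesis
      using mat_power_nonneg[OF assms(1,2)] r by (simp add: abs_mult power_mult_distrib mult_ac)
  qed
  moreover have "summable (\<lambda>n. f x / f y * (c * r) ^ n)"
    using rc r assms(3) by (intro summable_mult summable_geometric) auto
  ultimately show "summable (\<lambda>n. mat_power V A n x y * of_real r ^ n)"
    by (rule summable_comparison_test'[rotated])
qed

text \<open>Prolonging walks from \<open>x'\<close> to \<open>y'\<close> by fixed walks from
  \<open>x\<close> to \<open>x'\<close> and from \<open>y'\<close> to \<open>y\<close> compares the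
  two entries up to a constant factor and an index shift. Bounded terms thus pass from one entry to
  any other.\<close>

lemma mat_power_terms_bounded:
  assumes V: "x \<in> V" "y \<in> V" "x' \<in> V" "y' \<in> V"
    and r: "r > 0" "ereal r < conv_radius (\<lambda>n. mat_power V A n x y)"
  shows "\<exists>C. \<forall>n. mat_power V A n x' y' * r ^ n \<le> C"
proof -
  have "summable (\<lambda>n. mat_power V A n x y * r ^ n)"
    using r by (intro summable_in_conv_radius) simp
  then have "Bseq (\<lambda>n. mat_power V A n x y * r ^ n)"
    by (intro convergent_imp_Bseq) (auto dest: summable_LIMSEQ_zero convergentI)
  then obtain C where C: "norm (mat_power V A n x y * r ^ n) \<le> C" for n
    by (auto simp: Bseq_def)
  obtain l where l: "mat_power V A l x x' > 0"
    using irreducible V by blast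
  obtain m where m: "mat_power V A m y' y > 0"
    using irreducible V by blast
  \<comment> \<open>\<open>d\<close> collects the weights of the two connecting walks and the power
    of \<open>r\<close> for their \<open>l + m\<close> extra steps.\<close>
  define d where "d = mat_power V A l x x' * mat_power V A m y' y * r ^ (l + m)"
  have d: "d > 0"
    using l m r by (simp add: d_def)
  have "mat_power V A n x' y' * r ^ n \<le> C / d" for n
  proof -
    have "mat_power V A l x x' * mat_power V A n x' y' * mat_power V A m y' y
        \<le> mat_power V A (l + n) x y' * mat_power V A m y' y"
      using mat_power_add_ge[of x y' x' l n] V m by (intro mult_right_mono) auto
    also have "\<dots> \<le> mat_power V A (l + n + m) x y"
      using mat_power_add_ge V by blast
    finally have "mat_power V A l x x' * mat_power V A n x' y' * mat_power V A m y' y *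
        r ^ (l + n + m) \<le> mat_power V A (l + n + m) x y * r ^ (l + n + m)"
      using r by (intro mult_right_mono) auto
    also have "\<dots> \<le> C"
      using C[of "l + n + m"] by auto
    finally have "mat_power V A n x' y' * r ^ n * d \<le> C"
      by (simp add: d_def power_add mult_ac)
    then show ?thesis
      using d by (simp add: field_simps)
  qed
  then show ?thesis
    by blast
qed

text \<open>For \<open>r\<close> strictly between \<open>1 / c\<close> and a larger radius, all
  \<open>A ^ n\<close> entries from \<open>p\<close> into \<open>F\<close>, times
  \<open>r ^ n\<close>, would be bounded. By \<open>mat_power_ge\<close> their sum weighted by
  \<open>v\<close> is at least \<open>(c * r) ^ n * v p\<close>, which is unbounded.\<close>

lemma conv_radius_le:
  assumes "x \<in> V" "y \<in> V" "c > 0" "finite F" "F \<subseteq> V"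
    and supp: "\<And>z. z \<in> V - F \<Longrightarrow> v z = 0"
    and nonneg: "\<And>z. z \<in> V \<Longrightarrow> v z \<ge> 0"
    and o: "p \<in> V" "v p > 0"
    and sub: "\<And>z. z \<in> V \<Longrightarrow> c * v z \<le> (\<Sum>\<^sub>\<infinity>w\<in>V. A z w * v w)"
  shows "conv_radius (\<lambda>n. mat_power V A n x y) \<le> ereal (1 / c)"
proof (rule ccontr)
  assume "\<not> ?thesis"
  then obtain r where r: "ereal (1 / c) < ereal r" "ereal r < conv_radius (\<lambda>n. mat_power V A n x y)"
    by (metis ereal_dense2 not_le)
  have rc: "c * r > 1" "r > 0"
    using r(1) assms(3) by (simp_all add: field_simps)
      (metis less_trans mult_pos_pos zero_less_one zero_less_mult_pos)
  have "\<forall>z\<in>F. \<exists>C. \<forall>n. mat_power V A n p z * r ^ n \<le> C"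
    using mat_power_terms_bounded[OF assms(1,2) o(1) _ rc(2) r(2)] assms(5) by auto
  then obtain C where C: "\<And>z n. z \<in> F \<Longrightarrow> mat_power V A n p z * r ^ n \<le> C z"
    by metis
  have bound: "(c * r) ^ n * v p \<le> (\<Sum>z\<in>F. C z * v z)" for n
  proof -
    have "(c * r) ^ n * v p = c ^ n * v p * r ^ n"
      by (simp add: power_mult_distrib)
    also have "\<dots> \<le> (\<Sum>z\<in>F. mat_power V A n p z * v z) * r ^ n"
      using mat_power_ge[OF o(1), of c F v n] assms(3-5) supp sub rc
      by (intro mult_right_mono) auto
    also have "\<dots> = (\<Sum>z\<in>F. (mat_power V A n p z * r ^ n) * v z)"
      unfolding sum_distrib_right by (simp only: mult_ac)
    also have "\<dots> \<le> (\<Sum>z\<in>F. C z * v z)"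
      using C nonneg assms(5) by (intro sum_mono mult_right_mono) auto
    finally show ?thesis .
  qed
  obtain n where "(\<Sum>z\<in>F. C z * v z) / v p < (c * r) ^ n"
    using real_arch_pow[OF rc(1)] by blast
  then show False
    using bound[of n] o(2) by (simp add: field_simps)
qed

text \<open>The vectors of finite support are asked for only at rates \<open>c\<close> below
  \<open>\<rho>\<close>, which is what truncating an infinitely supported vector can deliver.
  Letting \<open>c\<close> tend to \<open>\<rho>\<close> closes the gap.\<close>

lemma comb_spectral_radius_eqI:
  assumes V: "x \<in> V" "y \<in> V" and "\<rho> > 0"
    and f: "\<And>z. z \<in> V \<Longrightarrow> f z > 0"
      "\<And>z. z \<in> V \<Longrightarrow> (\<Sum>\<^sub>\<infinity>w\<in>V. A z w * f w) \<le> \<rho> * f z"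
    and v: "\<And>c. 0 < c \<Longrightarrow> c < \<rho> \<Longrightarrow> \<exists>v. finite {z \<in> V. v z \<noteq> 0} \<and> (\<forall>z\<in>V. v z \<ge> 0) \<and>
      (\<exists>z\<in>V. v z > 0) \<and> (\<forall>z\<in>V. c * v z \<le> (\<Sum>\<^sub>\<infinity>w\<in>V. A z w * v w))"
  shows "comb_spectral_radius V A x y = ereal \<rho>"
proof -
  let ?R = "conv_radius (\<lambda>n. mat_power V A n x y)"
  have le: "?R \<le> ereal (1 / c)" if c: "0 < c" "c < \<rho>" for c
  proof -
    obtain v p where v: "finite {z \<in> V. v z \<noteq> 0}" "\<And>z. z \<in> V \<Longrightarrow> v z \<ge> 0"
      "p \<in> V" "v p > 0" "\<And>z. z \<in> V \<Longrightarrow> c * v z \<le> (\<Sum>\<^sub>\<infinity>w\<in>V. A z w * v w)"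
      using v[OF c] by auto
    show ?thesis
      by (rule conv_radius_le[OF V c(1) v(1) _ _ v(2) v(3,4) v(5)]) auto
  qed
  have "?R \<le> ereal (1 / \<rho>)"
  proof (rule ccontr)
    assume "\<not> ?thesis"
    \<comment> \<open>At \<open>c = 1 / r\<close>, which is below \<open>\<rho>\<close>, the bound
      \<open>le\<close> says that the radius is at most \<open>r\<close>.\<close>
    then obtain r where r: "ereal (1 / \<rho>) < ereal r" "ereal r < ?R"
      by (metis ereal_dense2 not_le)
    have "0 < 1 / \<rho>"
      using \<open>\<rho> > 0\<close> by simp
    then have "r > 0"
      using r(1) by (simp only: less_ereal.simps)
    moreover from this have "1 / r < \<rho>"
      using r(1) \<open>\<rho> > 0\<close> by (simp add: field_simps)
    ultimately show False
      using le[of "1 / r"] r(2) by simp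
  qed
  moreover have "?R \<ge> ereal (1 / \<rho>)"
    by (rule conv_radius_ge[OF V \<open>\<rho> > 0\<close> f(2) f(1)])
  ultimately have "?R = ereal (1 / \<rho>)"
    by (rule antisym)
  then show ?thesis
    using \<open>\<rho> > 0\<close> by (simp add: comb_spectral_radius_def)
qed

end

section \<open>The weighted spider\<close>

locale spider =
  fixes N :: nat and \<gamma>1 \<gamma>3 :: real and \<gamma>2 :: "nat \<Rightarrow> real"
  assumes legs: "N \<ge> 1"
    and \<gamma>1_nonneg: "\<gamma>1 \<ge> 0"
    and \<gamma>2_pos: "1 \<le> k \<Longrightarrow> k \<le> N \<Longrightarrow> \<gamma>2 k > 0"
    and \<gamma>3_pos: "\<gamma>3 > 0"
begin

abbreviation "V \<equiv> spider_vertices N"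
abbreviation "A \<equiv> spider_adj N \<gamma>1 \<gamma>2 \<gamma>3"

definition S2 :: real where "S2 = (\<Sum>k=1..N. \<gamma>2 k)"

lemma S2_pos: "S2 > 0"
  unfolding S2_def using legs \<gamma>2_pos by (intro sum_pos) auto

lemma origin_in: "spider_origin \<in> V"
  using legs by (force simp: spider_vertices_def spider_vertex_def)

lemma vertex_in: "1 \<le> k \<Longrightarrow> k \<le> N \<Longrightarrow> spider_vertex n k \<in> V"
  by (auto simp: spider_vertices_def)

section \<open>Rows of the spider matrix\<close>

lemma vertex_cases:
  assumes "x \<in> V"
  obtains "x = spider_origin"
  | n k where "1 \<le> k" "k \<le> N" "x = (Suc n, k)"
  using assms by (auto simp: spider_vertices_def spider_vertex_def gr0_conv_Suc split: if_splits)

text \<open>The origin is spelled with \<open>Suc 0\<close>, the form into which the simplifier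
  brings \<open>1\<close>, so that the equation works as a rewrite rule.\<close>

lemma adj_origin:
  "A (0, Suc 0) y = (if y = spider_origin then \<gamma>1 else
     if fst y = 1 \<and> 1 \<le> snd y \<and> snd y \<le> N then \<gamma>2 (snd y) else 0)"
  by (cases y) (auto simp: spider_adj_def spider_vertex_def)

text \<open>Naming the inner neighbour \<open>spider_vertex n k\<close> covers \<open>n = 0\<close>
  as well, where that neighbour is the origin.\<close>

lemma adj_leg:
  assumes "1 \<le> k" "k \<le> N"
  shows "A (Suc n, k) y = (if y = (Suc (Suc n), k) \<or> y = spider_vertex n k then \<gamma>3 else 0)"
  using assms by (auto simp: spider_adj_def spider_vertex_def split: if_splits)

sublocale row_finite_matrix V A
proof
  fix x y assume "x \<in> V" "y \<in> V"
  show "A x y \<ge> 0"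
    using \<open>x \<in> V\<close>
    by (cases rule: vertex_cases)
      (use \<gamma>1_nonneg \<gamma>3_pos \<gamma>2_pos in \<open>auto simp: adj_origin adj_leg less_imp_le\<close>)
next
  fix x assume "x \<in> V"
  then show "finite {z \<in> V. A x z \<noteq> 0}"
  proof (cases rule: vertex_cases)
    case 1
    have "{z \<in> V. A x z \<noteq> 0} \<subseteq> insert spider_origin ({1} \<times> {1..N})"
      by (auto simp: 1 adj_origin split: if_splits)
    then show ?thesis
      by (rule finite_subset) simp
  next
    case (2 n k)
    have "{z \<in> V. A x z \<noteq> 0} \<subseteq> {(Suc (Suc n), k), spider_vertex n k}"
      using 2 by (auto simp: adj_leg split: if_splits)
    then show ?thesis
      by (rule finite_subset) simp
  qed
qed

section \<open>Functions of the distance to the origin\<close>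

lemma radial_origin:
  "(\<Sum>\<^sub>\<infinity>z\<in>V. A spider_origin z * F (fst z)) = \<gamma>1 * F 0 + S2 * F 1"
proof -
  let ?R = "Pair 1 ` {1..N}"
  have "(\<Sum>\<^sub>\<infinity>z\<in>V. A spider_origin z * F (fst z)) =
      (\<Sum>z\<in>insert spider_origin ?R. A spider_origin z * F (fst z))"
  proof (rule row_infsum_superset[OF origin_in])
    have "(1, k) \<in> V" if "1 \<le> k" "k \<le> N" for k
      using vertex_in[OF that, of 1] by (simp add: spider_vertex_def)
    then show "insert spider_origin ?R \<subseteq> V"
      using origin_in by auto
    show "A spider_origin z = 0" if "z \<in> V - insert spider_origin ?R" for z
      using that by (cases z) (auto simp: adj_origin)
  qed simp
  also have "\<dots> = A spider_origin spider_origin * F 0 + (\<Sum>z\<in>?R. A spider_origin z * F (fst z))"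
    by (subst sum.insert) auto
  \<comment> \<open>\<open>F\<close> has the same value at all \<open>N\<close> neighbours, so the
    leg weights enter only through their sum.\<close>
  also have "(\<Sum>z\<in>?R. A spider_origin z * F (fst z)) = S2 * F 1"
    by (subst sum.reindex) (auto simp: inj_on_def adj_origin S2_def sum_distrib_right)
  finally show ?thesis
    by (simp add: adj_origin)
qed

lemma radial_leg:
  assumes "1 \<le> k" "k \<le> N"
  shows "(\<Sum>\<^sub>\<infinity>z\<in>V. A (Suc n, k) z * F (fst z)) = \<gamma>3 * (F (Suc (Suc n)) + F n)"
proof -
  let ?R = "{(Suc (Suc n), k), spider_vertex n k}"
  have "(\<Sum>\<^sub>\<infinity>z\<in>V. A (Suc n, k) z * F (fst z)) = (\<Sum>z\<in>?R. A (Suc n, k) z * F (fst z))"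
  proof (rule row_infsum_superset)
    show "(Suc n, k) \<in> V"
      using vertex_in[OF assms, of "Suc n"] by (simp add: spider_vertex_def)
    show "?R \<subseteq> V"
      using vertex_in[OF assms, of "Suc (Suc n)"] vertex_in[OF assms, of n]
      by (simp add: spider_vertex_def)
  qed (use assms in \<open>auto simp: adj_leg\<close>)
  also have "\<dots> = \<gamma>3 * (F (Suc (Suc n)) + F n)"
    using assms by (subst sum.insert) (auto simp: adj_leg spider_vertex_def algebra_simps)
  finally show ?thesis .
qed

section \<open>Connectedness of the spider\<close>

lemma leg_reach:
  assumes "1 \<le> k" "k \<le> N"
  shows "\<exists>m. mat_power V A m (spider_vertex n k) spider_origin > 0"
    and "\<exists>m. mat_power V A m spider_origin (spider_vertex n k) > 0"
proof -
  \<comment> \<open>The matrix is not symmetric, but both directions of every edge on a leg carry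
    positive weight, so induction along the leg gives reachability both ways.\<close>
  have edge: "A (spider_vertex (Suc n) k) (spider_vertex n k) > 0 \<and>
      A (spider_vertex n k) (spider_vertex (Suc n) k) > 0" for n
    using adj_leg[OF assms] adj_origin \<gamma>3_pos \<gamma>2_pos assms
    by (cases n) (auto simp: spider_vertex_def)
  have step: "mat_power V A 1 (spider_vertex (Suc n) k) (spider_vertex n k) > 0 \<and>
      mat_power V A 1 (spider_vertex n k) (spider_vertex (Suc n) k) > 0" for n
    using mat_power_1_ge vertex_in[OF assms] edge[of n] by (meson less_le_trans)
  have "(\<exists>m. mat_power V A m (spider_vertex n k) spider_origin > 0) \<and>
      (\<exists>m. mat_power V A m spider_origin (spider_vertex n k) > 0)"
  proof (induction n)
    case 0
    have "mat_power V A 0 spider_origin spider_origin > 0"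
      by simp
    then show ?case
      by (auto simp: spider_vertex_def simp del: mat_power.simps)
  next
    case (Suc n)
    then show ?case
      using step[of n] mat_power_reach_trans vertex_in[OF assms] origin_in by blast
  qed
  then show "\<exists>m. mat_power V A m (spider_vertex n k) spider_origin > 0"
    and "\<exists>m. mat_power V A m spider_origin (spider_vertex n k) > 0"
    by auto
qed

sublocale irreducible_matrix V A
proof
  fix x y assume xy: "x \<in> V" "y \<in> V"
  have "\<exists>m. mat_power V A m x spider_origin > 0"
    using xy(1) leg_reach(1) by (auto simp: spider_vertices_def)
  moreover have "\<exists>m. mat_power V A m spider_origin y > 0"
    using xy(2) leg_reach(2) by (auto simp: spider_vertices_def)
  ultimately show "\<exists>m. mat_power V A m x y > 0"
    using mat_power_reach_trans[OF xy(1) origin_in xy(2)] by blast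
qed

text \<open>Composing sequences with \<open>fst\<close> turns the vector inequalities into a
  boundary condition at the origin and one three-term inequality shared by all legs.\<close>

lemma comb_spectral_radius_radialI:
  assumes "x \<in> V" "y \<in> V" "\<rho> > 0"
    and f: "\<And>n. f n > 0" "\<gamma>1 * f 0 + S2 * f 1 \<le> \<rho> * f 0"
      "\<And>n. \<gamma>3 * (f (Suc (Suc n)) + f n) \<le> \<rho> * f (Suc n)"
    and v: "\<And>c. 0 < c \<Longrightarrow> c < \<rho> \<Longrightarrow> \<exists>v M. (\<forall>n\<ge>M. v n = 0) \<and> (\<forall>n. v n \<ge> 0) \<and> (\<exists>n. v n > 0) \<and>
      c * v 0 \<le> \<gamma>1 * v 0 + S2 * v 1 \<and> (\<forall>n. c * v (Suc n) \<le> \<gamma>3 * (v (Suc (Suc n)) + v n))"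
  shows "comb_spectral_radius V A x y = ereal \<rho>"
proof (rule comb_spectral_radius_eqI[where f = "\<lambda>z. f (fst z)", OF assms(1-3) f(1)])
  fix z assume "z \<in> V"
  then show "(\<Sum>\<^sub>\<infinity>w\<in>V. A z w * f (fst w)) \<le> \<rho> * f (fst z)"
    by (cases rule: vertex_cases) (use f in \<open>simp_all add: radial_origin[unfolded One_nat_def] radial_leg\<close>)
next
  fix c assume "0 < c" "c < \<rho>"
  then obtain v M p where v: "\<And>n. n \<ge> M \<Longrightarrow> v n = 0" "\<And>n. v n \<ge> 0" "v p > 0"
    "c * v 0 \<le> \<gamma>1 * v 0 + S2 * v 1" "\<And>n. c * v (Suc n) \<le> \<gamma>3 * (v (Suc (Suc n)) + v n)"
    using v by metis
  have "c * v (fst z) \<le> (\<Sum>\<^sub>\<infinity>w\<in>V. A z w * v (fst w))" if "z \<in> V" for z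
    using that by (cases rule: vertex_cases) (use v in \<open>simp_all add: radial_origin[unfolded One_nat_def] radial_leg\<close>)
  moreover have "finite {z \<in> V. v (fst z) \<noteq> 0}"
  proof (rule finite_subset)
    have "n < M" if "v n \<noteq> 0" for n
      using v(1) that not_le by blast
    then show "{z \<in> V. v (fst z) \<noteq> 0} \<subseteq> {..<M} \<times> {..Suc N}"
      using legs by (auto simp: spider_vertices_def spider_vertex_def split: if_splits)
  qed simp
  moreover have "\<exists>z\<in>V. v (fst z) > 0"
    using v(3) vertex_in[OF order_refl legs, of p]
    by (intro bexI[of _ "spider_vertex p 1"]) (auto simp: spider_vertex_def)
  ultimately show "\<exists>v. finite {z \<in> V. v z \<noteq> 0} \<and> (\<forall>z\<in>V. v z \<ge> 0) \<and>
      (\<exists>z\<in>V. v z > 0) \<and> (\<forall>z\<in>V. c * v z \<le> (\<Sum>\<^sub>\<infinity>w\<in>V. A z w * v w))"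
    using v(2) by (intro exI[of _ "\<lambda>z. v (fst z)"]) auto
qed

section \<open>The two regimes\<close>

lemma comb_spectral_radius_bulk:
  assumes "x \<in> V" "y \<in> V" "\<gamma>1 + S2 \<le> 2 * \<gamma>3"
  shows "comb_spectral_radius V A x y = ereal (2 * \<gamma>3)"
proof (rule comb_spectral_radius_radialI[where f = "\<lambda>_. 1", OF assms(1,2)])
  fix c assume c: "0 < c" "c < 2 * \<gamma>3"
  \<comment> \<open>This gives \<open>2 * \<gamma>3 \<le> (2 * \<gamma>3 - c) * M\<close>: the gap
    to \<open>c\<close>, times the least value of the bump inside its support, pays for its
    concavity.\<close>
  obtain M :: nat where M: "2 * \<gamma>3 / (2 * \<gamma>3 - c) < real M"
    using reals_Archimedean2 by blast
  \<comment> \<open>The bump vanishes at the origin, which makes the origin's inequality immediate,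
    and again from distance \<open>M + 1\<close> on.\<close>
  define v where "v = (\<lambda>n. max 0 (real n * (real (M + 1) - real n)))"
  have v_eq_0: "v n = 0" if "n \<ge> M + 1" for n
    using that by (auto simp: v_def max_def zero_le_mult_iff)
  have "c * v (Suc n) \<le> \<gamma>3 * (v (Suc (Suc n)) + v n)" for n
  proof (cases "n < M")
    case True
    let ?u = "\<lambda>n. real n * (real (M + 1) - real n)"
    have vSuc: "v (Suc n) = ?u (Suc n)"
      using True by (simp add: v_def)
    have "?u (Suc n) - real M = real n * (real M - 1 - real n)"
      by (simp add: algebra_simps)
    \<comment> \<open>On \<open>1, ..., M\<close> the concave bump is smallest at the two ends,
      where it equals \<open>M\<close>.\<close>
    moreover have "real n * (real M - 1 - real n) \<ge> 0"
      using True by (intro mult_nonneg_nonneg) auto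
    ultimately have "real M \<le> ?u (Suc n)"
      by linarith
    then have "2 * \<gamma>3 \<le> (2 * \<gamma>3 - c) * ?u (Suc n)"
      using M c by (smt (verit) divide_less_eq mult.commute mult_left_mono)
    \<comment> \<open>The second difference of this quadratic is constantly
      \<open>-2\<close>.\<close>
    moreover have "?u (Suc (Suc n)) + ?u n = 2 * ?u (Suc n) - 2"
      by (simp add: algebra_simps)
    ultimately have "c * ?u (Suc n) \<le> \<gamma>3 * (?u (Suc (Suc n)) + ?u n)"
      by (simp only: left_diff_distrib right_diff_distrib mult.assoc mult.left_commute)
    also have "\<dots> \<le> \<gamma>3 * (v (Suc (Suc n)) + v n)"
      using \<gamma>3_pos by (intro mult_left_mono add_mono) (auto simp: v_def)
    finally show ?thesis
      by (simp only: vSuc)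
  next
    case False
    then have "v (Suc n) = 0"
      by (intro v_eq_0) simp
    then show ?thesis
      using \<gamma>3_pos by (simp add: v_def)
  qed
  moreover have "0 < 2 * \<gamma>3 / (2 * \<gamma>3 - c)"
    using c \<gamma>3_pos by simp
  then have "M > 0"
    using M by (cases M) auto
  then have "v 1 > 0"
    by (simp add: v_def)
  moreover have "v 0 = 0" "\<forall>n. v n \<ge> 0"
    by (simp_all add: v_def)
  ultimately show "\<exists>v M. (\<forall>n\<ge>M. v n = 0) \<and> (\<forall>n. v n \<ge> 0) \<and> (\<exists>n. v n > 0) \<and>
      c * v 0 \<le> \<gamma>1 * v 0 + S2 * v 1 \<and> (\<forall>n. c * v (Suc n) \<le> \<gamma>3 * (v (Suc (Suc n)) + v n))"
    using S2_pos v_eq_0 by (intro exI[of _ v] exI[of _ "M + 1"]) auto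
qed (use assms(3) \<gamma>3_pos in auto)

text \<open>The root equation makes the eigenvalue \<open>\<gamma>1 + S2 * t\<close> forced at the
  origin agree with the eigenvalue \<open>\<gamma>3 * (t + 1 / t)\<close> forced along the legs, so
  \<open>t ^ n\<close> is a positive eigenvector.\<close>

lemma comb_spectral_radius_bound_state:
  assumes "x \<in> V" "y \<in> V" and t: "0 < t" "t < 1"
    and root: "\<gamma>3 * (1 + t\<^sup>2) = (\<gamma>1 + S2 * t) * t"
  shows "comb_spectral_radius V A x y = ereal (\<gamma>1 + S2 * t)"
proof -
  define \<rho> where "\<rho> = \<gamma>1 + S2 * t"
  have \<rho>_pos: "\<rho> > 0"
    using S2_pos \<gamma>1_nonneg t by (simp add: \<rho>_def add_nonneg_pos)
  have eigen: "\<gamma>3 * (t ^ Suc (Suc n) + t ^ n) = \<rho> * t ^ Suc n" for n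
  proof -
    have "\<gamma>3 * (t ^ Suc (Suc n) + t ^ n) = \<gamma>3 * (1 + t\<^sup>2) * t ^ n"
      by (simp add: algebra_simps power2_eq_square)
    then show ?thesis
      by (simp add: root \<rho>_def mult_ac)
  qed
  \<comment> \<open>The arithmetic-geometric mean inequality gives
    \<open>\<rho> \<ge> 2 * \<gamma>3\<close>, on which the truncation below relies.\<close>
  have "2 * \<gamma>3 * t \<le> \<gamma>3 * (1 + t\<^sup>2)"
    using mult_left_mono[OF sum_squares_bound[of 1 t], of \<gamma>3] \<gamma>3_pos by (simp add: mult_ac)
  then have \<rho>_ge: "2 * \<gamma>3 \<le> \<rho>"
    using t by (simp add: root \<rho>_def)
  have "comb_spectral_radius V A x y = ereal \<rho>"
  proof (rule comb_spectral_radius_radialI[where f = "\<lambda>n. t ^ n", OF assms(1,2) \<rho>_pos])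
    fix c assume c: "0 < c" "c < \<rho>"
    \<comment> \<open>The bound \<open>t / 2\<close> keeps the truncated values at distances 0 and 1
      positive; the other bound keeps the loss \<open>\<epsilon> * (\<gamma>1 + S2)\<close> at the
      origin within \<open>\<rho> - c\<close>.\<close>
    define \<epsilon> where "\<epsilon> = min (t / 2) ((\<rho> - c) / (\<gamma>1 + S2))"
    have \<epsilon>: "\<epsilon> > 0" "\<epsilon> < t" "\<epsilon> * (\<gamma>1 + S2) \<le> \<rho> - c"
    proof -
      show "\<epsilon> > 0" "\<epsilon> < t"
        using t c S2_pos \<gamma>1_nonneg by (auto simp: \<epsilon>_def)
      have "\<epsilon> \<le> (\<rho> - c) / (\<gamma>1 + S2)"
        by (simp add: \<epsilon>_def)
      then show "\<epsilon> * (\<gamma>1 + S2) \<le> \<rho> - c"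
        using S2_pos \<gamma>1_nonneg by (simp add: field_simps)
    qed
    define v where "v = (\<lambda>n. max 0 (t ^ n - \<epsilon>))"
    obtain M where M: "t ^ M < \<epsilon>"
      using real_arch_pow_inv[OF \<epsilon>(1) t(2)] by blast
    have "v n = 0" if "n \<ge> M" for n
    proof -
      have "t ^ n \<le> t ^ M"
        using that t by (intro power_decreasing) auto
      then show ?thesis
        using M by (simp add: v_def)
    qed
    moreover have v0: "v 0 = 1 - \<epsilon>" "v 1 = t - \<epsilon>"
      using \<epsilon> t by (simp_all add: v_def)
    moreover have "c * (1 - \<epsilon>) \<le> \<gamma>1 * (1 - \<epsilon>) + S2 * (t - \<epsilon>)"
      using \<epsilon>(3) mult_pos_pos[OF c(1) \<epsilon>(1)] by (simp add: \<rho>_def algebra_simps)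
    moreover have "c * v (Suc n) \<le> \<gamma>3 * (v (Suc (Suc n)) + v n)" for n
    proof (cases "t ^ Suc n \<le> \<epsilon>")
      case True
      then show ?thesis
        using \<gamma>3_pos by (simp add: v_def)
    next
      case False
      then have "c * v (Suc n) \<le> \<rho> * (t ^ Suc n - \<epsilon>)"
        using c by (auto simp: v_def intro: mult_right_mono)
      \<comment> \<open>Subtracting \<open>\<epsilon>\<close> costs
        \<open>2 * \<gamma>3 * \<epsilon>\<close> on the neighbours' side and
        \<open>\<rho> * \<epsilon>\<close>, at least as much, on the side of the vertex
        itself.\<close>
      also have "\<dots> \<le> \<rho> * t ^ Suc n - 2 * \<gamma>3 * \<epsilon>"
        using mult_right_mono[OF \<rho>_ge, of \<epsilon>] \<epsilon>(1) by (simp add: right_diff_distrib)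
      also have "\<dots> = \<gamma>3 * ((t ^ Suc (Suc n) - \<epsilon>) + (t ^ n - \<epsilon>))"
        unfolding eigen[symmetric] by (simp add: algebra_simps)
      also have "\<dots> \<le> \<gamma>3 * (v (Suc (Suc n)) + v n)"
        using \<gamma>3_pos by (intro mult_left_mono add_mono) (auto simp: v_def)
      finally show ?thesis .
    qed
    moreover have "\<forall>n. v n \<ge> 0"
      by (simp add: v_def)
    moreover have "\<exists>n. v n > 0"
      using \<epsilon> t v0 by (intro exI[of _ 0]) simp
    ultimately show "\<exists>v M. (\<forall>n\<ge>M. v n = 0) \<and> (\<forall>n. v n \<ge> 0) \<and> (\<exists>n. v n > 0) \<and>
        c * v 0 \<le> \<gamma>1 * v 0 + S2 * v 1 \<and> (\<forall>n. c * v (Suc n) \<le> \<gamma>3 * (v (Suc (Suc n)) + v n))"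
      by (intro exI[of _ v] exI[of _ M]) auto
  qed (use t eigen in \<open>auto simp: \<rho>_def\<close>)
  then show ?thesis
    by (simp add: \<rho>_def)
qed

end

section \<open>The closed form\<close>

lemma spider_discriminant_pos:
  fixes a S g :: real
  assumes "a \<ge> 0" "S > 0" "g > 0" "a + S > 2 * g"
  shows "a\<^sup>2 + 4 * g * (S - g) > (2 * g - a)\<^sup>2"
    and "a\<^sup>2 + 4 * g * (S - g) > 0"
proof -
  \<comment> \<open>The difference is \<open>-4 * g * \<Lambda>\<close>, so it is positive exactly
    when \<open>\<Lambda> < 0\<close>.\<close>
  have "a\<^sup>2 + 4 * g * (S - g) - (2 * g - a)\<^sup>2 = 4 * g * (a + S - 2 * g)"
    by (simp add: power2_eq_square algebra_simps)
  moreover have "4 * g * (a + S - 2 * g) > 0"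
    using assms by simp
  ultimately show "a\<^sup>2 + 4 * g * (S - g) > (2 * g - a)\<^sup>2"
    by linarith
  then show "a\<^sup>2 + 4 * g * (S - g) > 0"
    using zero_le_power2[of "2 * g - a"] by linarith
qed

text \<open>Only \<open>S > 2 * g\<close> can make the first summand negative. Then
  \<open>S > g\<close> puts the square root above \<open>a\<close>, and the second summand exceeds
  \<open>a * S\<close>.\<close>

lemma spider_denominator_pos:
  fixes a S g :: real
  assumes "a \<ge> 0" "S > 0" "g > 0" "a + S > 2 * g"
  shows "a * (2 * g - S) + S * sqrt (a\<^sup>2 + 4 * g * (S - g)) > 0"
proof (cases "S \<le> 2 * g")
  case True
  then show ?thesis
    using assms spider_discriminant_pos[OF assms] by (intro add_nonneg_pos) auto
next
  case False
  let ?D = "a\<^sup>2 + 4 * g * (S - g)"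
  have "a < sqrt ?D"
    using False assms(1,3) by (intro real_less_rsqrt) simp
  then have "a * S < S * sqrt ?D"
    using assms(2) by simp
  moreover have "a * (2 * g - S) \<ge> - (a * S)"
    using assms mult_nonneg_nonneg[of a g] by (simp add: algebra_simps)
  ultimately show ?thesis
    by linarith
qed

theorem proposition3p1:
  fixes N :: nat and \<gamma>1 \<gamma>3 :: real and \<gamma>2 :: "nat \<Rightarrow> real" and x y :: "nat \<times> nat"
  assumes "N \<ge> 1"
    and "\<gamma>1 \<ge> 0"
    and "\<And>k. 1 \<le> k \<Longrightarrow> k \<le> N \<Longrightarrow> \<gamma>2 k > 0"
    and "\<gamma>3 > 0"
    and "x \<in> spider_vertices N" and "y \<in> spider_vertices N"
  shows "let S2 = (\<Sum>k=1..N. \<gamma>2 k); \<Lambda> = 2 * \<gamma>3 - \<gamma>1 - S2 in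
    comb_spectral_radius (spider_vertices N) (spider_adj N \<gamma>1 \<gamma>2 \<gamma>3) x y =
      ereal (if \<Lambda> \<ge> 0 then 2 * \<gamma>3
             else 2 * \<gamma>3 * (\<gamma>1\<^sup>2 + S2\<^sup>2) /
                  (\<gamma>1 * (2 * \<gamma>3 - S2) + S2 * sqrt (\<gamma>1\<^sup>2 + 4 * \<gamma>3 * (S2 - \<gamma>3))))"
proof -
  interpret spider N \<gamma>1 \<gamma>3 \<gamma>2
    using assms by unfold_locales auto
  show ?thesis
  proof (cases "\<gamma>1 + S2 \<le> 2 * \<gamma>3")
    case True
    then show ?thesis
      using comb_spectral_radius_bulk[OF assms(5,6)] by (simp add: Let_def S2_def)
  next
    case False
    then have L: "\<gamma>1 + S2 > 2 * \<gamma>3"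
      by simp
    note D = spider_discriminant_pos[OF assms(2) S2_pos assms(4) L]
    define d where "d = sqrt (\<gamma>1\<^sup>2 + 4 * \<gamma>3 * (S2 - \<gamma>3))"
    have d2: "d\<^sup>2 = \<gamma>1\<^sup>2 + 4 * \<gamma>3 * (S2 - \<gamma>3)"
      using D(2) by (simp add: d_def)
    have d: "d > 0" "2 * \<gamma>3 - \<gamma>1 < d"
      using D by (auto simp: d_def intro: real_less_rsqrt)
    have pos: "\<gamma>1 + d > 0"
      using d assms(2) by simp
    \<comment> \<open>This is the root \<open>(\<gamma>1 - d) / (2 * (\<gamma>3 - S2))\<close> of
      \<open>(\<gamma>3 - S2) * t^2 - \<gamma>1 * t + \<gamma>3 = 0\<close>, rationalised so that it
      also makes sense for \<open>S2 = \<gamma>3\<close>. The bound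
      \<open>d > 2 * \<gamma>3 - \<gamma>1\<close> is what gives \<open>t < 1\<close>.\<close>
    define t where "t = 2 * \<gamma>3 / (\<gamma>1 + d)"
    have t: "0 < t" "t < 1"
      using pos d(2) assms(4) by (auto simp: t_def field_simps)
    have td: "t * (\<gamma>1 + d) = 2 * \<gamma>3"
      using pos by (simp add: t_def)
    \<comment> \<open>Multiplying by \<open>(\<gamma>1 + d)^2\<close> lets \<open>td\<close> clear
      every \<open>t\<close>; what remains is a polynomial identity modulo
      \<open>d2\<close>.\<close>
    have "\<gamma>3 * (1 + t\<^sup>2) * (\<gamma>1 + d)\<^sup>2 = \<gamma>3 * ((\<gamma>1 + d)\<^sup>2 + (t * (\<gamma>1 + d))\<^sup>2)"
      by (simp add: algebra_simps power2_eq_square)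
    also have "\<dots> = (\<gamma>1 * (\<gamma>1 + d) + S2 * (2 * \<gamma>3)) * (2 * \<gamma>3)"
      unfolding td using d2 by algebra
    also have "\<dots> = (\<gamma>1 + S2 * t) * t * (\<gamma>1 + d)\<^sup>2"
      unfolding td[symmetric] by (simp add: algebra_simps power2_eq_square)
    finally have "\<gamma>3 * (1 + t\<^sup>2) = (\<gamma>1 + S2 * t) * t"
      using pos by simp
    note rad = comb_spectral_radius_bound_state[OF assms(5,6) t this]
    have den: "\<gamma>1 * (2 * \<gamma>3 - S2) + S2 * d > 0"
      using spider_denominator_pos[OF assms(2) S2_pos assms(4) L] by (simp add: d_def)
    \<comment> \<open>The closed form is checked by cross-multiplication with both positive
      denominators, again modulo \<open>d2\<close>.\<close>
    have "(\<gamma>1 + S2 * t) * (\<gamma>1 * (2 * \<gamma>3 - S2) + S2 * d) * (\<gamma>1 + d) =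
        (\<gamma>1 * (\<gamma>1 + d) + S2 * (t * (\<gamma>1 + d))) * (\<gamma>1 * (2 * \<gamma>3 - S2) + S2 * d)"
      by (simp add: algebra_simps)
    also have "\<dots> = 2 * \<gamma>3 * (\<gamma>1\<^sup>2 + S2\<^sup>2) * (\<gamma>1 + d)"
      unfolding td using d2 by algebra
    finally have "\<gamma>1 + S2 * t = 2 * \<gamma>3 * (\<gamma>1\<^sup>2 + S2\<^sup>2) / (\<gamma>1 * (2 * \<gamma>3 - S2) + S2 * d)"
      using pos den by (subst eq_divide_eq) simp
    then show ?thesis
      using rad L by (simp add: Let_def S2_def d_def)
  qed
qed

end
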